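(* Let $\mathcal R$ be a cartesian 2-rig. Then every derivation $\partial:\mathcal R\to\mathcal R$ is trivial.
   Context: A 2-rig (for a 2-rig doctrine) is a monoidal category $(\mathcal R,\otimes,I)$, possibly with additional structure of a multiplicative doctrine, having all colimits of a prescribed class $\mathbb A$ of shapes that includes all finite discrete diagrams (finite coproducts are written $+$, the initial object $0$), such that $\otimes$ preserves these colimits in each variable separately; by default (the minimal doctrine) the class consists of finite coproducts only. A 2-rig is cartesian if its multiplicative monoidal product is cartesian, i.e. $\otimes$ is the categorical product and $I$ is terminal. A derivation on $\mathcal R$ is a functor $\partial:\mathcal R\to\mathcal R$ preserving the colimits in the class, equipped with a left strength $R\otimes\partial C\to\partial(R\otimes C)$ and a right strength $\partial C\otimes R\to\partial(C\otimes R)$, natural in both variables, satisfying the usual unit and associativity axioms for tensorial strengths and compatible with each other, such that the induced map $\partial C\otimes C'+C\otimes\partial C'\to\partial(C\otimes C')$ and the map $0\to\partial(I)$ are isomorphisms. A derivation is trivial if it is constantly $0$, i.e. $\partial X\cong 0$ for every object $X$. *)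

theory Defs
  imports Main
begin

text \<open>Categories are carrier-based: objects and arrows are subsets of the types
  \<open>'o\<close> and \<open>'m\<close>.  The composite \<open>g \<cdot> f\<close> is in applicative order and is meaningful only
  if \<open>Cod f = Dom g\<close>.\<close>

record ('o, 'm) cat =
  Ob :: "'o set"
  Ar :: "'m set"
  Dom :: "'m \<Rightarrow> 'o"
  Cod :: "'m \<Rightarrow> 'o"
  Idt :: "'o \<Rightarrow> 'm" ("\<one>\<index>")
  Cmp :: "'m \<Rightarrow> 'm \<Rightarrow> 'm" (infixl "\<cdot>\<index>" 55)

definition hom :: "('o, 'm, 'x) cat_scheme \<Rightarrow> 'o \<Rightarrow> 'o \<Rightarrow> 'm set"
  where "hom C a b = {f \<in> Ar C. Dom C f = a \<and> Cod C f = b}"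

locale category =
  fixes C :: "('o, 'm, 'x) cat_scheme" (structure)
  assumes dom_ob: "f \<in> Ar C \<Longrightarrow> Dom C f \<in> Ob C"
    and cod_ob: "f \<in> Ar C \<Longrightarrow> Cod C f \<in> Ob C"
    and idt_hom: "a \<in> Ob C \<Longrightarrow> \<one> a \<in> hom C a a"
    and cmp_hom: "\<lbrakk>f \<in> hom C a b; g \<in> hom C b c\<rbrakk> \<Longrightarrow> g \<cdot> f \<in> hom C a c"
    and cmp_idt_right: "f \<in> hom C a b \<Longrightarrow> f \<cdot> \<one> a = f"
    and cmp_idt_left: "f \<in> hom C a b \<Longrightarrow> \<one> b \<cdot> f = f"
    and cmp_assoc: "\<lbrakk>f \<in> hom C a b; g \<in> hom C b c; h \<in> hom C c d\<rbrakk>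
      \<Longrightarrow> h \<cdot> (g \<cdot> f) = (h \<cdot> g) \<cdot> f"

definition is_iso :: "('o, 'm, 'x) cat_scheme \<Rightarrow> 'm \<Rightarrow> bool"
  where "is_iso C f \<longleftrightarrow> f \<in> Ar C \<and>
    (\<exists>g \<in> hom C (Cod C f) (Dom C f).
      g \<cdot>\<^bsub>C\<^esub> f = \<one>\<^bsub>C\<^esub> (Dom C f) \<and> f \<cdot>\<^bsub>C\<^esub> g = \<one>\<^bsub>C\<^esub> (Cod C f))"

definition isomorphic :: "('o, 'm, 'x) cat_scheme \<Rightarrow> 'o \<Rightarrow> 'o \<Rightarrow> bool"
  where "isomorphic C a b \<longleftrightarrow> (\<exists>f \<in> hom C a b. is_iso C f)"

definition initial :: "('o, 'm, 'x) cat_scheme \<Rightarrow> 'o \<Rightarrow> bool"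
  where "initial C z \<longleftrightarrow> z \<in> Ob C \<and> (\<forall>a \<in> Ob C. \<exists>!f. f \<in> hom C z a)"

definition terminal :: "('o, 'm, 'x) cat_scheme \<Rightarrow> 'o \<Rightarrow> bool"
  where "terminal C t \<longleftrightarrow> t \<in> Ob C \<and> (\<forall>a \<in> Ob C. \<exists>!f. f \<in> hom C a t)"

definition is_product ::
    "('o, 'm, 'x) cat_scheme \<Rightarrow> 'o \<Rightarrow> 'o \<Rightarrow> 'o \<Rightarrow> 'm \<Rightarrow> 'm \<Rightarrow> bool"
  where "is_product C a b p pa pb \<longleftrightarrow>
    pa \<in> hom C p a \<and> pb \<in> hom C p b \<and>
    (\<forall>x. \<forall>f \<in> hom C x a. \<forall>g \<in> hom C x b.
      \<exists>!h. h \<in> hom C x p \<and> pa \<cdot>\<^bsub>C\<^esub> h = f \<and> pb \<cdot>\<^bsub>C\<^esub> h = g)"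

definition is_coproduct ::
    "('o, 'm, 'x) cat_scheme \<Rightarrow> 'o \<Rightarrow> 'o \<Rightarrow> 'o \<Rightarrow> 'm \<Rightarrow> 'm \<Rightarrow> bool"
  where "is_coproduct C a b s ia ib \<longleftrightarrow>
    ia \<in> hom C a s \<and> ib \<in> hom C b s \<and>
    (\<forall>x. \<forall>f \<in> hom C a x. \<forall>g \<in> hom C b x.
      \<exists>!h. h \<in> hom C s x \<and> h \<cdot>\<^bsub>C\<^esub> ia = f \<and> h \<cdot>\<^bsub>C\<^esub> ib = g)"

record ('o, 'm, 'p, 'n) functor_data =
  ob_map :: "'o \<Rightarrow> 'p"
  ar_map :: "'m \<Rightarrow> 'n"

definition functor_comp ::
    "('p, 'n, 'q, 'k) functor_data \<Rightarrow> ('o, 'm, 'p, 'n) functor_data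
      \<Rightarrow> ('o, 'm, 'q, 'k) functor_data"
  where "functor_comp G F =
    \<lparr>ob_map = (\<lambda>a. ob_map G (ob_map F a)), ar_map = (\<lambda>f. ar_map G (ar_map F f))\<rparr>"

locale cat_functor = source: category C + target: category D
  for C :: "('o, 'm, 'x) cat_scheme" and D :: "('p, 'n, 'y) cat_scheme" +
  fixes F :: "('o, 'm, 'p, 'n) functor_data"
  assumes map_ob: "a \<in> Ob C \<Longrightarrow> ob_map F a \<in> Ob D"
    and map_hom: "f \<in> hom C a b \<Longrightarrow> ar_map F f \<in> hom D (ob_map F a) (ob_map F b)"
    and map_idt: "a \<in> Ob C \<Longrightarrow> ar_map F (\<one>\<^bsub>C\<^esub> a) = \<one>\<^bsub>D\<^esub> (ob_map F a)"
    and map_cmp: "\<lbrakk>f \<in> hom C a b; g \<in> hom C b c\<rbrakk>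
      \<Longrightarrow> ar_map F (g \<cdot>\<^bsub>C\<^esub> f) = ar_map F g \<cdot>\<^bsub>D\<^esub> ar_map F f"

definition cocone ::
    "('i, 'j) cat \<Rightarrow> ('o, 'm, 'x) cat_scheme \<Rightarrow> ('i, 'j, 'o, 'm) functor_data
      \<Rightarrow> 'o \<Rightarrow> ('i \<Rightarrow> 'm) \<Rightarrow> bool"
  where "cocone J C D v k \<longleftrightarrow> v \<in> Ob C \<and>
    (\<forall>i \<in> Ob J. k i \<in> hom C (ob_map D i) v) \<and>
    (\<forall>u \<in> Ar J. k (Cod J u) \<cdot>\<^bsub>C\<^esub> ar_map D u = k (Dom J u))"

definition is_colimit ::
    "('i, 'j) cat \<Rightarrow> ('o, 'm, 'x) cat_scheme \<Rightarrow> ('i, 'j, 'o, 'm) functor_data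
      \<Rightarrow> 'o \<Rightarrow> ('i \<Rightarrow> 'm) \<Rightarrow> bool"
  where "is_colimit J C D v k \<longleftrightarrow> cocone J C D v k \<and>
    (\<forall>w l. cocone J C D w l \<longrightarrow>
      (\<exists>!h. h \<in> hom C v w \<and> (\<forall>i \<in> Ob J. h \<cdot>\<^bsub>C\<^esub> k i = l i)))"

definition has_colimits :: "('i, 'j) cat \<Rightarrow> ('o, 'm, 'x) cat_scheme \<Rightarrow> bool"
  where "has_colimits J C \<longleftrightarrow>
    (\<forall>D. cat_functor J C D \<longrightarrow> (\<exists>v k. is_colimit J C D v k))"

definition preserves_colimits ::
    "('i, 'j) cat \<Rightarrow> ('o, 'm, 'x) cat_scheme \<Rightarrow> ('p, 'n, 'y) cat_scheme
      \<Rightarrow> ('o, 'm, 'p, 'n) functor_data \<Rightarrow> bool"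
  where "preserves_colimits J C C' F \<longleftrightarrow>
    (\<forall>D v k. cat_functor J C D \<longrightarrow> is_colimit J C D v k \<longrightarrow>
      is_colimit J C' (functor_comp F D) (ob_map F v) (\<lambda>i. ar_map F (k i)))"

definition discrete :: "('o, 'm, 'x) cat_scheme \<Rightarrow> bool"
  where "discrete C \<longleftrightarrow> Ar C = Idt C ` Ob C"

text \<open>A class of shapes lives in fixed types \<open>'i\<close>, \<open>'j\<close>, so it contains the finite discrete
  categories only up to isomorphism: one of each finite cardinality.\<close>

definition shape_class :: "('i, 'j) cat set \<Rightarrow> bool"
  where "shape_class \<A> \<longleftrightarrow> (\<forall>J \<in> \<A>. category J) \<and>
    (\<forall>n. \<exists>J \<in> \<A>. discrete J \<and> finite (Ob J) \<and> card (Ob J) = n)"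

record ('o, 'm) moncat = "('o, 'm) cat" +
  tensor_ob :: "'o \<Rightarrow> 'o \<Rightarrow> 'o" (infixr "\<otimes>\<index>" 70)
  tensor_ar :: "'m \<Rightarrow> 'm \<Rightarrow> 'm" (infixr "\<odot>\<index>" 70)
  munit :: "'o"
  assoc :: "'o \<Rightarrow> 'o \<Rightarrow> 'o \<Rightarrow> 'm"
  lunit :: "'o \<Rightarrow> 'm"
  runit :: "'o \<Rightarrow> 'm"

locale monoidal_category = category R
  for R :: "('o, 'm, 'x) moncat_scheme" (structure) +
  assumes tensor_ob: "\<lbrakk>a \<in> Ob R; b \<in> Ob R\<rbrakk> \<Longrightarrow> a \<otimes> b \<in> Ob R"
    and munit_ob: "munit R \<in> Ob R"
    and tensor_hom: "\<lbrakk>f \<in> hom R a b; g \<in> hom R c d\<rbrakk>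
      \<Longrightarrow> f \<odot> g \<in> hom R (a \<otimes> c) (b \<otimes> d)"
    and tensor_idt: "\<lbrakk>a \<in> Ob R; b \<in> Ob R\<rbrakk> \<Longrightarrow> \<one> a \<odot> \<one> b = \<one> (a \<otimes> b)"
    and interchange:
      "\<lbrakk>f \<in> hom R a b; f' \<in> hom R b c; g \<in> hom R a' b'; g' \<in> hom R b' c'\<rbrakk>
        \<Longrightarrow> (f' \<cdot> f) \<odot> (g' \<cdot> g) = (f' \<odot> g') \<cdot> (f \<odot> g)"
    and assoc_hom: "\<lbrakk>a \<in> Ob R; b \<in> Ob R; c \<in> Ob R\<rbrakk>
      \<Longrightarrow> assoc R a b c \<in> hom R ((a \<otimes> b) \<otimes> c) (a \<otimes> (b \<otimes> c))"
    and assoc_iso: "\<lbrakk>a \<in> Ob R; b \<in> Ob R; c \<in> Ob R\<rbrakk> \<Longrightarrow> is_iso R (assoc R a b c)"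
    and assoc_natural:
      "\<lbrakk>f \<in> hom R a a'; g \<in> hom R b b'; h \<in> hom R c c'\<rbrakk>
        \<Longrightarrow> assoc R a' b' c' \<cdot> ((f \<odot> g) \<odot> h) = (f \<odot> (g \<odot> h)) \<cdot> assoc R a b c"
    and lunit_hom: "a \<in> Ob R \<Longrightarrow> lunit R a \<in> hom R (munit R \<otimes> a) a"
    and lunit_iso: "a \<in> Ob R \<Longrightarrow> is_iso R (lunit R a)"
    and lunit_natural: "f \<in> hom R a b
      \<Longrightarrow> lunit R b \<cdot> (\<one> (munit R) \<odot> f) = f \<cdot> lunit R a"
    and runit_hom: "a \<in> Ob R \<Longrightarrow> runit R a \<in> hom R (a \<otimes> munit R) a"
    and runit_iso: "a \<in> Ob R \<Longrightarrow> is_iso R (runit R a)"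
    and runit_natural: "f \<in> hom R a b
      \<Longrightarrow> runit R b \<cdot> (f \<odot> \<one> (munit R)) = f \<cdot> runit R a"
    and pentagon: "\<lbrakk>a \<in> Ob R; b \<in> Ob R; c \<in> Ob R; d \<in> Ob R\<rbrakk>
      \<Longrightarrow> assoc R a b (c \<otimes> d) \<cdot> assoc R (a \<otimes> b) c d
        = (\<one> a \<odot> assoc R b c d) \<cdot> assoc R a (b \<otimes> c) d \<cdot> (assoc R a b c \<odot> \<one> d)"
    and triangle: "\<lbrakk>a \<in> Ob R; b \<in> Ob R\<rbrakk>
      \<Longrightarrow> (\<one> a \<odot> lunit R b) \<cdot> assoc R a (munit R) b = runit R a \<odot> \<one> b"

definition tensor_left ::
    "('o, 'm, 'x) moncat_scheme \<Rightarrow> 'o \<Rightarrow> ('o, 'm, 'o, 'm) functor_data"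
  where "tensor_left R a =
    \<lparr>ob_map = (\<lambda>b. a \<otimes>\<^bsub>R\<^esub> b), ar_map = (\<lambda>f. \<one>\<^bsub>R\<^esub> a \<odot>\<^bsub>R\<^esub> f)\<rparr>"

definition tensor_right ::
    "('o, 'm, 'x) moncat_scheme \<Rightarrow> 'o \<Rightarrow> ('o, 'm, 'o, 'm) functor_data"
  where "tensor_right R a =
    \<lparr>ob_map = (\<lambda>b. b \<otimes>\<^bsub>R\<^esub> a), ar_map = (\<lambda>f. f \<odot>\<^bsub>R\<^esub> \<one>\<^bsub>R\<^esub> a)\<rparr>"

text \<open>A 2-rig for the doctrine given by the class \<open>\<A>\<close> of colimit shapes.  Any additional
  structure of a multiplicative doctrine may sit in the extension slot of the record.\<close>

locale two_rig = monoidal_category R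
  for R :: "('o, 'm, 'x) moncat_scheme" (structure) +
  fixes \<A> :: "('i, 'j) cat set"
  assumes shapes: "shape_class \<A>"
    and colimits: "J \<in> \<A> \<Longrightarrow> has_colimits J R"
    and tensor_left_colimits:
      "\<lbrakk>J \<in> \<A>; a \<in> Ob R\<rbrakk> \<Longrightarrow> preserves_colimits J R R (tensor_left R a)"
    and tensor_right_colimits:
      "\<lbrakk>J \<in> \<A>; a \<in> Ob R\<rbrakk> \<Longrightarrow> preserves_colimits J R R (tensor_right R a)"

text \<open>The projections of \<open>a \<otimes> b\<close> are the canonical ones, obtained by discarding one factor
  along the unique arrow to the terminal unit and applying a unitor.\<close>

locale cartesian_two_rig = two_rig +
  assumes munit_terminal: "terminal R (munit R)"
    and tensor_product:
      "\<lbrakk>a \<in> Ob R; b \<in> Ob R; s \<in> hom R a (munit R); t \<in> hom R b (munit R)\<rbrakk>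
        \<Longrightarrow> is_product R a b (a \<otimes> b)
              (runit R a \<cdot> (\<one> a \<odot> t)) (lunit R b \<cdot> (s \<odot> \<one> b))"

text \<open>The left strength is \<open>\<tau> r c : r \<otimes> d c \<rightarrow> d (r \<otimes> c)\<close>, the right
  strength is \<open>\<sigma> c r : d c \<otimes> r \<rightarrow> d (c \<otimes> r)\<close>.  In \<open>leibniz\<close>, \<open>m\<close> is the arrow
  induced by \<open>\<sigma>\<close> and \<open>\<tau>\<close> on a coproduct, which exists in every 2-rig.\<close>

locale derivation = two_rig + endo: cat_functor R R d
  for d :: "('o, 'm, 'o, 'm) functor_data" +
  fixes \<tau> \<sigma> :: "'o \<Rightarrow> 'o \<Rightarrow> 'm"
  assumes preserves: "J \<in> \<A> \<Longrightarrow> preserves_colimits J R R d"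
    and left_hom: "\<lbrakk>r \<in> Ob R; c \<in> Ob R\<rbrakk>
      \<Longrightarrow> \<tau> r c \<in> hom R (r \<otimes> ob_map d c) (ob_map d (r \<otimes> c))"
    and right_hom: "\<lbrakk>c \<in> Ob R; r \<in> Ob R\<rbrakk>
      \<Longrightarrow> \<sigma> c r \<in> hom R (ob_map d c \<otimes> r) (ob_map d (c \<otimes> r))"
    and left_natural: "\<lbrakk>f \<in> hom R r r'; g \<in> hom R c c'\<rbrakk>
      \<Longrightarrow> \<tau> r' c' \<cdot> (f \<odot> ar_map d g) = ar_map d (f \<odot> g) \<cdot> \<tau> r c"
    and right_natural: "\<lbrakk>g \<in> hom R c c'; f \<in> hom R r r'\<rbrakk>
      \<Longrightarrow> \<sigma> c' r' \<cdot> (ar_map d g \<odot> f) = ar_map d (g \<odot> f) \<cdot> \<sigma> c r"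
    and left_unit: "c \<in> Ob R
      \<Longrightarrow> ar_map d (lunit R c) \<cdot> \<tau> (munit R) c = lunit R (ob_map d c)"
    and right_unit: "c \<in> Ob R
      \<Longrightarrow> ar_map d (runit R c) \<cdot> \<sigma> c (munit R) = runit R (ob_map d c)"
    and left_assoc: "\<lbrakk>r \<in> Ob R; s \<in> Ob R; c \<in> Ob R\<rbrakk>
      \<Longrightarrow> ar_map d (assoc R r s c) \<cdot> \<tau> (r \<otimes> s) c
        = \<tau> r (s \<otimes> c) \<cdot> (\<one> r \<odot> \<tau> s c) \<cdot> assoc R r s (ob_map d c)"
    and right_assoc: "\<lbrakk>c \<in> Ob R; r \<in> Ob R; s \<in> Ob R\<rbrakk>
      \<Longrightarrow> ar_map d (assoc R c r s) \<cdot> \<sigma> (c \<otimes> r) s \<cdot> (\<sigma> c r \<odot> \<one> s)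
        = \<sigma> c (r \<otimes> s) \<cdot> assoc R (ob_map d c) r s"
    and compatible: "\<lbrakk>r \<in> Ob R; c \<in> Ob R; s \<in> Ob R\<rbrakk>
      \<Longrightarrow> ar_map d (assoc R r c s) \<cdot> \<sigma> (r \<otimes> c) s \<cdot> (\<tau> r c \<odot> \<one> s)
        = \<tau> r (c \<otimes> s) \<cdot> (\<one> r \<odot> \<sigma> c s) \<cdot> assoc R r (ob_map d c) s"
    and leibniz: "\<lbrakk>c \<in> Ob R; c' \<in> Ob R;
        is_coproduct R (ob_map d c \<otimes> c') (c \<otimes> ob_map d c') p i j;
        m \<in> hom R p (ob_map d (c \<otimes> c')); m \<cdot> i = \<sigma> c c'; m \<cdot> j = \<tau> c c'\<rbrakk>
      \<Longrightarrow> is_iso R m"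
    and unit_zero:
      "\<lbrakk>initial R z; m \<in> hom R z (ob_map d (munit R))\<rbrakk> \<Longrightarrow> is_iso R m"

definition trivial_derivation ::
    "('o, 'm, 'x) cat_scheme \<Rightarrow> ('o, 'm, 'o, 'm) functor_data \<Rightarrow> bool"
  where "trivial_derivation R d \<longleftrightarrow>
    (\<exists>z. initial R z \<and> (\<forall>a \<in> Ob R. isomorphic R (ob_map d a) z))"

end

theory Submission
  imports Defs
begin

text \<open>The initial object \<open>0\<close> of a cartesian 2-rig is strict, that is, every arrow into it is
  invertible.  Tensoring with an object \<open>a\<close> preserves the empty colimit, so \<open>a \<otimes> 0\<close> is again
  initial; given \<open>f : a \<rightarrow> 0\<close>, the universal property of the product makes \<open>a\<close> a retract of
  \<open>a \<otimes> 0\<close> by pairing \<open>f\<close> with the identity, and this forces \<open>a \<cong> 0\<close> (\<open>initial_strict\<close>).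

  A derivation \<open>d\<close> kills the unit, \<open>d I \<cong> 0\<close>, and in a cartesian 2-rig \<open>I\<close> is terminal.  So every
  object \<open>a\<close> has an arrow \<open>d a \<rightarrow> d I \<cong> 0\<close>, the image of \<open>a \<rightarrow> I\<close>, and strictness gives
  \<open>d a \<cong> 0\<close>.\<close>

lemma hom_obD:
  assumes "category C" and "f \<in> hom C a b"
  shows "a \<in> Ob C" and "b \<in> Ob C"
  using category.dom_ob[OF assms(1), of f] category.cod_ob[OF assms(1), of f] assms(2)
  by (auto simp: hom_def)

lemma initial_arrow_unique:
  assumes "category C" and "initial C z" and "f \<in> hom C z a" and "g \<in> hom C z a"
  shows "f = g"
  using assms hom_obD(2)[OF assms(1,3)] unfolding initial_def by blast

lemma is_isoI:
  assumes "f \<in> hom C a b" and "g \<in> hom C b a"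
    and "g \<cdot>\<^bsub>C\<^esub> f = \<one>\<^bsub>C\<^esub> a" and "f \<cdot>\<^bsub>C\<^esub> g = \<one>\<^bsub>C\<^esub> b"
  shows "is_iso C f"
  using assms unfolding is_iso_def hom_def by auto

text \<open>On a shape without objects, a diagram and the legs of a cocone carry no information.  Below,
  \<open>undefined\<close> therefore stands for the empty diagram and for the legs of its colimit.\<close>

lemma is_colimit_empty_iff_initial:
  assumes "category J" and "Ob J = {}"
  shows "is_colimit J C D v k \<longleftrightarrow> initial C v"
proof -
  have "Ar J = {}"
    using category.dom_ob[OF assms(1)] assms(2) by blast
  then show ?thesis
    using assms(2) unfolding is_colimit_def cocone_def initial_def by auto
qed

lemma cat_functor_empty:
  assumes "category J" and "Ob J = {}" and "category C"
  shows "cat_functor J C D"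
proof -
  have "hom J a b = {}" for a b
    using category.dom_ob[OF assms(1)] assms(2) by (auto simp: hom_def)
  then show ?thesis
    using assms by (simp add: cat_functor_def cat_functor_axioms_def)
qed

context two_rig
begin

lemma empty_shape:
  obtains J where "J \<in> \<A>" and "category J" and "Ob J = {}"
proof -
  obtain J where "J \<in> \<A>" "finite (Ob J)" "card (Ob J) = 0"
    using shapes unfolding shape_class_def by blast
  then show thesis
    using shapes that unfolding shape_class_def by auto
qed

lemma initial_exists: "\<exists>z. initial R z"
proof -
  obtain J where J: "J \<in> \<A>" "category J" "Ob J = {}"
    by (rule empty_shape)
  have "cat_functor J R undefined"
    using J(2,3) category_axioms by (rule cat_functor_empty)
  then obtain v k where "is_colimit J R undefined v k"
    using colimits[OF J(1)] unfolding has_colimits_def by fast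
  then show ?thesis
    using is_colimit_empty_iff_initial[OF J(2,3)] by fast
qed

lemma tensor_initial:
  assumes "a \<in> Ob R" and "initial R z"
  shows "initial R (a \<otimes> z)"
proof -
  obtain J where J: "J \<in> \<A>" "category J" "Ob J = {}"
    by (rule empty_shape)
  have "cat_functor J R undefined"
    using J(2,3) category_axioms by (rule cat_functor_empty)
  moreover have "is_colimit J R undefined z undefined"
    using assms(2) by (simp add: is_colimit_empty_iff_initial[OF J(2,3)])
  ultimately have "is_colimit J R (functor_comp (tensor_left R a) undefined)
      (ob_map (tensor_left R a) z) (\<lambda>i. ar_map (tensor_left R a) (undefined i))"
    using tensor_left_colimits[OF J(1) assms(1), unfolded preserves_colimits_def, rule_format]
    by simp
  then show ?thesis
    by (simp add: is_colimit_empty_iff_initial[OF J(2,3)] tensor_left_def)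
qed

end

text \<open>Write \<open>p\<close> and \<open>q\<close> for the projections of \<open>a \<otimes> z\<close> and \<open>u\<close> for the arrow \<open>z \<rightarrow> a\<close>.  As
  \<open>a \<otimes> z\<close> is initial, \<open>p = u \<cdot> q\<close>; precomposing with the pairing of \<open>\<one> a\<close> and \<open>f\<close> turns this
  into \<open>\<one> a = u \<cdot> f\<close>.\<close>

lemma (in cartesian_two_rig) initial_strict:
  assumes z: "initial R z" and f: "f \<in> hom R a z"
  shows "is_iso R f"
proof -
  have a: "a \<in> Ob R" and zO: "z \<in> Ob R"
    using hom_obD[OF category_axioms f] by auto
  obtain s t where "s \<in> hom R a (munit R)" "t \<in> hom R z (munit R)"
    using munit_terminal a zO unfolding terminal_def by blast
  then obtain p q where prod: "is_product R a z (a \<otimes> z) p q"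
    using tensor_product[OF a zO] by blast
  then have p: "p \<in> hom R (a \<otimes> z) a" and q: "q \<in> hom R (a \<otimes> z) z"
    unfolding is_product_def by auto
  obtain h where h: "h \<in> hom R a (a \<otimes> z)" "p \<cdot> h = \<one> a" "q \<cdot> h = f"
    using prod idt_hom[OF a] f unfolding is_product_def by blast
  obtain u where u: "u \<in> hom R z a"
    using z a unfolding initial_def by blast
  have "p = u \<cdot> q"
    using category_axioms tensor_initial[OF a z] p cmp_hom[OF q u] by (rule initial_arrow_unique)
  then have "u \<cdot> f = \<one> a"
    using cmp_assoc[OF h(1) q u] h(2,3) by simp
  moreover have "f \<cdot> u = \<one> z"
    using category_axioms z cmp_hom[OF u f] idt_hom[OF zO] by (rule initial_arrow_unique)
  ultimately show ?thesis
    using f u by (intro is_isoI)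
qed

theorem proposition4p8:
  fixes R :: "('o, 'm, 'x) moncat_scheme"
    and \<A> :: "('i, 'j) cat set"
    and d :: "('o, 'm, 'o, 'm) functor_data"
    and \<tau> \<sigma> :: "'o \<Rightarrow> 'o \<Rightarrow> 'm"
  assumes "cartesian_two_rig R \<A>"
    and "derivation R \<A> d \<tau> \<sigma>"
  shows "trivial_derivation R d"
proof -
  interpret cartesian_two_rig R \<A> by (fact assms(1))
  interpret derivation R \<A> d \<tau> \<sigma> by (fact assms(2))
  obtain z where z: "initial R z"
    using initial_exists by blast
  obtain m where m: "m \<in> hom R z (ob_map d (munit R))"
    using z endo.map_ob[OF munit_ob] unfolding initial_def by blast
  have "is_iso R m"
    using z m by (rule unit_zero)
  then obtain g where g: "g \<in> hom R (ob_map d (munit R)) z"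
    using m unfolding is_iso_def hom_def by auto
  have "isomorphic R (ob_map d a) z" if a: "a \<in> Ob R" for a
  proof -
    obtain t where "t \<in> hom R a (munit R)"
      using munit_terminal a unfolding terminal_def by blast
    then have "g \<cdot>\<^bsub>R\<^esub> ar_map d t \<in> hom R (ob_map d a) z"
      using g by (blast intro: cmp_hom endo.map_hom)
    then show ?thesis
      unfolding isomorphic_def using initial_strict[OF z] by blast
  qed
  then show ?thesis
    unfolding trivial_derivation_def using z by blast
qed

end
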